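(* Let $p$ be a prime and $r\ge1$ an integer. Let $f\in\mathbb{Q}[x]$ be a $p^r$-pure polynomial of degree $d>1$. Suppose $g(x)=bx^e+p^sh(x)\in\mathbb{Q}[x]$, with $e\ge1$, $\nu_p(b)=0$, $h\in\mathbb{Q}[x]$, $\deg(h)\le e-1$, $\nu_p(h)\ge0$, and $s$ an integer with $s>\frac{r}{d}$. Then $f\circ g$ is $p^r$-pure.
   Context: $\nu_p$ denotes the $p$-adic valuation on $\mathbb{Q}$ (with $\nu_p(0)=\infty$); for $h=\sum h_ix^i\in\mathbb{Q}[x]$, $\nu_p(h)=\min_i\nu_p(h_i)$. A polynomial $q(x)=a_nx^n+\dots+a_0\in\mathbb{Q}[x]$ of degree $n$ is $p^r$-pure if $\nu_p(a_n)=0$, $\nu_p(a_0)=r$, and $\frac{\nu_p(a_i)}{n-i}\ge\frac{r}{n}$ for all $1\le i\le n-1$. *)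

theory Defs
  imports
    "HOL-Computational_Algebra.Computational_Algebra"
    "HOL-Library.Extended_Real"
begin

definition padic_val :: "nat \<Rightarrow> rat \<Rightarrow> ereal" where
  "padic_val p x =
     (if x = 0 then \<infinity>
      else let (a, b) = quotient_of x in
        ereal (real (multiplicity (int p) a) - real (multiplicity (int p) b)))"

definition padic_val_poly :: "nat \<Rightarrow> rat poly \<Rightarrow> ereal" where
  "padic_val_poly p h = Min ((\<lambda>i. padic_val p (coeff h i)) ` {..degree h})"

definition pure_poly :: "nat \<Rightarrow> int \<Rightarrow> rat poly \<Rightarrow> bool" where
  "pure_poly p r q \<longleftrightarrow>
     padic_val p (lead_coeff q) = 0 \<and>
     padic_val p (coeff q 0) = ereal (of_int r) \<and>
     (\<forall>i\<in>{1..degree q - 1}.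
        padic_val p (coeff q i) / ereal (real (degree q - i))
          \<ge> ereal (of_int r / real (degree q)))"

end

theory Submission
  imports Defs
begin

text \<open>Put \<open>\<lambda> = r / (d e)\<close>, let \<open>x\<close> have weight \<open>\<lambda>\<close>, and give a polynomial the weight
  \<open>w(q) = min\<^sub>i (\<nu>\<^sub>p(q\<^sub>i) + i \<lambda>)\<close>, which is superadditive under products. The hypotheses on \<open>g\<close>
  give \<open>w(g) \<ge> r / d\<close>, and purity of \<open>f\<close> says \<open>\<nu>\<^sub>p(a\<^sub>i) \<ge> r - i r / d\<close>; so every summand
  \<open>a\<^sub>i g\<^sup>i\<close> of the composition has weight at least \<open>r\<close>, which is the slope condition.
  Since \<open>\<nu>\<^sub>p(g(0)) \<ge> s > r / d\<close>, the term \<open>a\<^sub>0\<close> strictly dominates in \<open>f(g(0))\<close>.\<close>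

section \<open>The p-adic valuation of rationals\<close>

lemma padic_val_0 [simp]: "padic_val p 0 = \<infinity>"
  by (simp add: padic_val_def)

text \<open>Frees the valuation from lowest terms: cross-multiplying with the reduced fraction
  \<open>n / m\<close> gives \<open>a * m = n * b\<close>, and multiplicities of the prime add on
  both sides.\<close>

lemma padic_val_divide_of_int:
  assumes "prime p" "a \<noteq> 0" "b \<noteq> 0"
  shows "padic_val p (of_int a / of_int b) =
           ereal (real (multiplicity (int p) a) - real (multiplicity (int p) b))"
proof -
  define x :: rat where "x = of_int a / of_int b"
  obtain n m where q: "quotient_of x = (n, m)" by (cases "quotient_of x")
  have m: "m > 0" using quotient_of_denom_pos[OF q] .
  have x: "x = of_int n / of_int m" using quotient_of_div[OF q] .
  have "x \<noteq> 0" using assms by (simp add: x_def)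
  then have n: "n \<noteq> 0" using x by auto
  have "(of_int (a * m) :: rat) = of_int (n * b)"
    using x assms m unfolding x_def by (simp add: field_simps)
  then have "a * m = n * b" by (simp only: of_int_eq_iff)
  moreover have pe: "prime_elem (int p)" using assms by simp
  ultimately have "multiplicity (int p) a + multiplicity (int p) m =
      multiplicity (int p) n + multiplicity (int p) b"
    using assms m n prime_elem_multiplicity_mult_distrib[OF pe, of a m]
      prime_elem_multiplicity_mult_distrib[OF pe, of n b] by simp
  then have "real (multiplicity (int p) a) + real (multiplicity (int p) m) =
      real (multiplicity (int p) n) + real (multiplicity (int p) b)"
    by (simp flip: of_nat_add)
  then show ?thesis using \<open>x \<noteq> 0\<close> q unfolding padic_val_def x_def[symmetric] by simp
qed

lemma rat_common_denominator:
  fixes x y :: rat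
  obtains a b c :: int where "c \<noteq> 0" "x = of_int a / of_int c" "y = of_int b / of_int c"
proof -
  obtain a1 c1 where 1: "quotient_of x = (a1, c1)" by fastforce
  obtain b2 c2 where 2: "quotient_of y = (b2, c2)" by fastforce
  show ?thesis
    by (rule that[of "c1 * c2" "a1 * c2" "b2 * c1"]) (use 1[THEN quotient_of_div] 2[THEN quotient_of_div]
        1[THEN quotient_of_denom_pos] 2[THEN quotient_of_denom_pos] in auto)
qed

lemma padic_val_mult:
  assumes "prime p"
  shows "padic_val p (x * y) = padic_val p x + padic_val p y"
proof (cases "x = 0 \<or> y = 0")
  case False
  obtain a b c where abc: "c \<noteq> 0" "x = of_int a / of_int c" "y = of_int b / of_int c"
    by (rule rat_common_denominator)
  have nz: "a \<noteq> 0" "b \<noteq> 0" using False abc by auto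
  have xy: "x * y = of_int (a * b) / of_int (c * c)" using abc by simp
  have "padic_val p (x * y) = ereal (real (multiplicity (int p) (a * b)) - real (multiplicity (int p) (c * c)))"
    unfolding xy using abc(1) nz assms by (intro padic_val_divide_of_int) auto
  then show ?thesis
    using abc(1) nz assms unfolding abc(2,3)
    by (simp add: padic_val_divide_of_int prime_elem_multiplicity_mult_distrib)
qed (auto simp: padic_val_def)

text \<open>The ultrametric inequality: over a common denominator it reduces to the fact that the
  smaller power of \<open>p\<close> dividing \<open>a\<close> and \<open>b\<close> divides
  \<open>a + b\<close>. The real threshold \<open>t\<close> keeps infinite valuations out of the
  arithmetic.\<close>

lemma padic_val_add_ge:
  assumes "prime p" "ereal t \<le> padic_val p x" "ereal t \<le> padic_val p y"
  shows "ereal t \<le> padic_val p (x + y)"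
proof (cases "x = 0 \<or> y = 0 \<or> x + y = 0")
  case False
  obtain a b c where abc: "c \<noteq> 0" "x = of_int a / of_int c" "y = of_int b / of_int c"
    by (rule rat_common_denominator)
  have nz: "a \<noteq> 0" "b \<noteq> 0" using False abc by auto
  have xy: "x + y = of_int (a + b) / of_int c" using abc by (simp add: add_divide_distrib)
  have nz': "a + b \<noteq> 0" using False xy by auto
  let ?m = "\<lambda>n. multiplicity (int p) n"
  let ?k = "min (?m a) (?m b)"
  have "int p ^ ?k dvd a + b"
    by (intro dvd_add multiplicity_dvd') auto
  then have "?k \<le> ?m (a + b)"
    using nz' assms(1) by (intro multiplicity_geI) (auto simp: prime_gt_1_nat)
  moreover have "t \<le> real (?m a) - real (?m c)" "t \<le> real (?m b) - real (?m c)"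
    using assms(2,3) unfolding abc(2,3)
    by (simp_all only: padic_val_divide_of_int[OF assms(1)] nz abc(1) ereal_less_eq not_False_eq_True)
  ultimately have "t \<le> real (?m (a + b)) - real (?m c)" by linarith
  then show ?thesis
    unfolding xy padic_val_divide_of_int[OF assms(1) nz' abc(1)] by simp
next
  case True
  then show ?thesis using assms by (elim disjE) simp_all
qed

lemma padic_val_sum_ge:
  assumes "prime p" "\<And>i. i \<in> A \<Longrightarrow> ereal t \<le> padic_val p (f i)"
  shows "ereal t \<le> padic_val p (sum f A)"
  using assms(2)
  by (induction A rule: infinite_finite_induct) (simp_all add: padic_val_add_ge[OF assms(1)])

lemma padic_val_of_int:
  "prime p \<Longrightarrow> a \<noteq> 0 \<Longrightarrow> padic_val p (of_int a) = ereal (real (multiplicity (int p) a))"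
  using padic_val_divide_of_int[of p a 1] by simp

lemma padic_val_1: "prime p \<Longrightarrow> padic_val p 1 = 0"
  using padic_val_of_int[of p 1] by (simp add: zero_ereal_def)

lemma padic_val_uminus: "prime p \<Longrightarrow> padic_val p (- x) = padic_val p x"
  using padic_val_mult[of p "-1" x] padic_val_of_int[of p "-1"]
  by (simp add: multiplicity_unit_right flip: zero_ereal_def)

lemma padic_val_of_nat_power: "prime p \<Longrightarrow> padic_val p (of_nat p ^ n) = ereal (real n)"
  using padic_val_of_int[of p "int p ^ n"] by (simp add: prime_gt_0_nat multiplicity_same_power)

lemma padic_val_mult_ge:
  assumes "prime p" "ereal t \<le> padic_val p x" "ereal u \<le> padic_val p y"
  shows "ereal (t + u) \<le> padic_val p (x * y)"
  using add_mono[OF assms(2,3)] by (simp add: padic_val_mult[OF assms(1)])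

lemma padic_val_power_ge:
  assumes "prime p" "ereal t \<le> padic_val p x"
  shows "ereal (real n * t) \<le> padic_val p (x ^ n)"
proof (induction n)
  case (Suc n)
  then show ?case using padic_val_mult_ge[OF assms Suc] by (simp add: algebra_simps)
qed (simp add: padic_val_1[OF assms(1)] flip: zero_ereal_def)

lemma padic_val_power_eq_0:
  assumes "prime p" "padic_val p x = 0"
  shows "padic_val p (x ^ n) = 0"
  by (induction n) (simp_all add: assms padic_val_1 padic_val_mult)

text \<open>If the sum had valuation above \<open>t\<close>, then \<open>x = (x + y) + (- y)\<close>
  would be a sum of two terms of valuation above \<open>t\<close>.\<close>

lemma padic_val_add_dominant:
  assumes "prime p" "padic_val p x = ereal t" "ereal u \<le> padic_val p y" "t < u"
  shows "padic_val p (x + y) = ereal t"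
proof (rule antisym)
  have "ereal t \<le> ereal u" using assms by simp
  then have "ereal t \<le> padic_val p y" using assms(3) by (rule order_trans)
  then show "ereal t \<le> padic_val p (x + y)"
    using assms by (intro padic_val_add_ge) auto
  show "padic_val p (x + y) \<le> ereal t"
  proof (rule ccontr)
    assume "\<not> ?thesis"
    then have "ereal t < padic_val p (x + y)" by simp
    \<comment> \<open>The valuation of \<open>x + y\<close> may be infinite, so a real threshold
      \<open>v\<close> is interpolated before \<open>padic_val_add_ge\<close> is applied.\<close>
    then obtain v where v: "ereal t < ereal v" "ereal v < padic_val p (x + y)"
      using ereal_dense2 by blast
    define m where "m = min u v"
    have m: "ereal m \<le> ereal u" "ereal m \<le> ereal v" by (auto simp: m_def)
    have "ereal m \<le> padic_val p (x + y)" using order_trans[OF m(2) less_imp_le[OF v(2)]] .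
    moreover have "ereal m \<le> padic_val p (- y)"
      using order_trans[OF m(1) assms(3)] assms(1) by (simp add: padic_val_uminus)
    ultimately have "ereal m \<le> padic_val p (x + y + - y)"
      by (rule padic_val_add_ge[OF assms(1)])
    then have "ereal m \<le> ereal t" using assms by simp
    then show False using v assms by (simp add: m_def min_def split: if_splits)
  qed
qed

section \<open>Weighted lower bounds for polynomials\<close>

text \<open>Says that the weight is at least \<open>t\<close> when the variable has weight
  \<open>l\<close>; a bound replaces the minimum. Indices above the degree are harmless, as zero has
  infinite valuation.\<close>

definition weight_ge :: "nat \<Rightarrow> real \<Rightarrow> real \<Rightarrow> rat poly \<Rightarrow> bool" where
  "weight_ge p l t q \<longleftrightarrow> (\<forall>i. ereal (t - real i * l) \<le> padic_val p (coeff q i))"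

lemma weight_ge_sum:
  assumes "prime p" "\<And>i. i \<in> A \<Longrightarrow> weight_ge p l t (q i)"
  shows "weight_ge p l t (sum q A)"
  using assms by (auto simp: weight_ge_def coeff_sum intro: padic_val_sum_ge)

text \<open>In each convolution term the indices add up to \<open>n\<close>, so the variable
  contributes \<open>n * l\<close> however it is split.\<close>

lemma weight_ge_mult:
  assumes "prime p" "weight_ge p l t q" "weight_ge p l u q'"
  shows "weight_ge p l (t + u) (q * q')"
  unfolding weight_ge_def coeff_mult
proof (intro allI padic_val_sum_ge[OF assms(1)])
  fix n i :: nat assume i: "i \<in> {..n}"
  have "ereal ((t - real i * l) + (u - real (n - i) * l)) \<le> padic_val p (coeff q i * coeff q' (n - i))"
    using assms by (intro padic_val_mult_ge) (auto simp: weight_ge_def)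
  moreover have "(t - real i * l) + (u - real (n - i) * l) = t + u - real n * l"
    using i by (simp add: of_nat_diff algebra_simps)
  ultimately show "ereal (t + u - real n * l) \<le> padic_val p (coeff q i * coeff q' (n - i))"
    by simp
qed

lemma weight_ge_const:
  assumes "ereal t \<le> padic_val p c"
  shows "weight_ge p l t [:c:]"
  using assms by (auto simp: weight_ge_def coeff_pCons split: nat.splits)

lemma weight_ge_power:
  assumes "prime p" "weight_ge p l t q"
  shows "weight_ge p l (real n * t) (q ^ n)"
proof (induction n)
  case 0
  have "weight_ge p l 0 [:1:]"
    by (rule weight_ge_const) (simp add: padic_val_1[OF assms(1)] flip: zero_ereal_def)
  then show ?case by (simp add: one_pCons)
next
  case (Suc n)
  then show ?case using weight_ge_mult[OF assms Suc] by (simp add: algebra_simps)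
qed

lemma pcompose_conv_sum: "f \<circ>\<^sub>p g = (\<Sum>i\<le>degree f. [:coeff f i:] * g ^ i)"
  by (simp add: pcompose_altdef poly_altdef coeff_map_poly degree_map_poly)

text \<open>The variable of \<open>f\<close> gets the weight \<open>t\<close> that bounds the weight
  of \<open>g\<close>: the deficit \<open>i * t\<close> allowed to the \<open>i\<close>-th
  coefficient is made up by \<open>g ^ i\<close>.\<close>

lemma weight_ge_pcompose:
  assumes "prime p" "weight_ge p t u f" "weight_ge p l t g"
  shows "weight_ge p l u (f \<circ>\<^sub>p g)"
  unfolding pcompose_conv_sum
proof (rule weight_ge_sum[OF assms(1)])
  fix i
  have "weight_ge p l (u - real i * t) [:coeff f i:]"
    using assms(2) by (intro weight_ge_const) (auto simp: weight_ge_def)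
  from weight_ge_mult[OF assms(1) this weight_ge_power[OF assms(1,3), of i]]
  show "weight_ge p l u ([:coeff f i:] * g ^ i)" by simp
qed

text \<open>Multiplying the slope condition by \<open>n - i > 0\<close> turns it into the weight
  bound at the inner indices. The remaining bounds read \<open>r\<close> at index 0 and 0 at index
  \<open>n\<close>, which the two equalities supply, and concern zero coefficients beyond.\<close>

lemma pure_poly_iff_weight_ge:
  assumes "degree q > 0"
  shows "pure_poly p r q \<longleftrightarrow> padic_val p (lead_coeff q) = 0 \<and>
     padic_val p (coeff q 0) = ereal (of_int r) \<and>
     weight_ge p (of_int r / real (degree q)) (of_int r) q"
proof -
  define n where "n = degree q"
  have slope: "ereal (of_int r / real n) \<le> padic_val p (coeff q i) / ereal (real (n - i)) \<longleftrightarrow>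
      ereal (of_int r - real i * (of_int r / real n)) \<le> padic_val p (coeff q i)"
    if "i < n" for i
  proof -
    have "real (n - i) * (of_int r / real n) = of_int r - real i * (of_int r / real n)"
      using that by (simp add: of_nat_diff field_simps)
    then show ?thesis using that by (simp add: ereal_le_divide_pos)
  qed
  have ends: "ereal (of_int r - real i * (of_int r / real n)) \<le> padic_val p (coeff q i)"
    if "padic_val p (coeff q n) = 0" "padic_val p (coeff q 0) = ereal (of_int r)"
      "i \<notin> {1..n - 1}" for i
  proof -
    consider "i = 0" | "i = n" | "i > n" using \<open>i \<notin> _\<close> by fastforce
    then show ?thesis
      using that assms by cases (auto simp: n_def coeff_eq_0 zero_ereal_def)
  qed
  have inner: "i < n" if "i \<in> {1..n - 1}" for i using that by auto
  show ?thesis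
    unfolding pure_poly_def weight_ge_def n_def[symmetric]
  proof (intro conj_cong refl iffI ballI allI)
    fix i
    assume "padic_val p (coeff q n) = 0" "padic_val p (coeff q 0) = ereal (of_int r)"
      and *: "\<forall>i\<in>{1..n - 1}. ereal (of_int r / real n) \<le> padic_val p (coeff q i) / ereal (real (n - i))"
    then show "ereal (of_int r - real i * (of_int r / real n)) \<le> padic_val p (coeff q i)"
      using ends[of i] bspec[OF *, of i] slope[OF inner, of i] by (cases "i \<in> {1..n - 1}") auto
  next
    fix i
    assume *: "\<forall>i. ereal (of_int r - real i * (of_int r / real n)) \<le> padic_val p (coeff q i)"
      and "i \<in> {1..n - 1}"
    then show "ereal (of_int r / real n) \<le> padic_val p (coeff q i) / ereal (real (n - i))"
      using slope[OF inner] by blast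
  qed
qed

section \<open>Purity of the composition\<close>

lemma padic_val_coeff_ge:
  assumes "0 \<le> padic_val_poly p h"
  shows "0 \<le> padic_val p (coeff h i)"
proof (cases "i \<le> degree h")
  case True
  then have "padic_val_poly p h \<le> padic_val p (coeff h i)"
    unfolding padic_val_poly_def by (intro Min_le) auto
  then show ?thesis using assms by (rule order_trans[rotated])
qed (simp add: coeff_eq_0)

theorem theorem3p7:
  fixes p e :: nat and r s :: int and f g h :: "rat poly" and b :: rat
  assumes "prime p"
    and "r \<ge> 1"
    and "pure_poly p r f"
    and "degree f > 1"
    and "g = monom b e + smult (of_nat p powi s) h"
    and "e \<ge> 1"
    and "padic_val p b = 0"
    and "degree h \<le> e - 1"
    and "padic_val_poly p h \<ge> 0"
    and "real_of_int s > real_of_int r / real (degree f)"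
  shows "pure_poly p r (f \<circ>\<^sub>p g)"
proof -
  define d where "d = degree f"
  define t where "t = real_of_int r / real d"
  \<comment> \<open>Chosen so that \<open>x ^ e\<close> has weight \<open>t\<close>; as
    \<open>b\<close> has valuation 0, the leading term of \<open>g\<close> then has weight exactly
    \<open>t\<close>.\<close>
  define l where "l = t / real e"
  have d: "d > 1" and t: "t > 0" and st: "real_of_int s > t" and e: "e > 0"
    using assms by (auto simp: d_def t_def)
  have l: "l \<ge> 0" using t by (simp add: l_def)
  \<comment> \<open>Positivity turns the integer power \<open>powi s\<close> into the natural power
    with exponent \<open>nat s\<close>.\<close>
  have "s > 0" using st t by linarith
  have f: "padic_val p (coeff f d) = 0" "padic_val p (coeff f 0) = ereal (of_int r)"
      "weight_ge p t (of_int r) f"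
    using assms(3,4) pure_poly_iff_weight_ge[of f p r] by (auto simp: t_def d_def)
  have b: "b \<noteq> 0" using assms(7) by auto
  have ph: "ereal (of_int s) \<le> padic_val p (of_nat p powi s * coeff h i)" for i
    using padic_val_mult_ge[OF assms(1), of "of_int s" "of_nat p powi s" 0 "coeff h i"]
      padic_val_coeff_ge[OF assms(9), of i] padic_val_of_nat_power[OF assms(1), of "nat s"] \<open>s > 0\<close>
    by (simp add: power_int_def zero_ereal_def)
  have g_low: "coeff g i = of_nat p powi s * coeff h i" if "i \<noteq> e" for i
    using that by (simp add: assms(5))
  have he: "coeff h i = 0" if "i \<ge> e" for i
    using that assms(8) e by (intro coeff_eq_0) linarith
  have ge: "coeff g e = b" by (simp add: assms(5) he)
  have dg: "degree g = e"
  proof (rule antisym)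
    show "degree g \<le> e" by (rule degree_le) (auto simp: g_low he)
    show "e \<le> degree g" using ge b by (intro le_degree) auto
  qed
  have wg: "weight_ge p l t g"
    unfolding weight_ge_def
  proof
    fix i
    show "ereal (t - real i * l) \<le> padic_val p (coeff g i)"
    proof (cases "i = e")
      case True
      then show ?thesis using ge assms(7) e by (simp add: l_def zero_ereal_def)
    next
      case False
      \<comment> \<open>Away from index \<open>e\<close> the factor \<open>p ^ s\<close> alone
        suffices, since \<open>l \<ge> 0\<close> and \<open>t < s\<close>.\<close>
      have "t - real i * l \<le> of_int s" using st l by (smt (verit) mult_nonneg_nonneg of_nat_0_le_iff)
      then have "ereal (t - real i * l) \<le> ereal (of_int s)" by simp
      also note ph[of i]
      finally show ?thesis by (simp add: g_low[OF False])
    qed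
  qed
  have deg: "degree (f \<circ>\<^sub>p g) = d * e" by (simp add: degree_pcompose dg d_def)
  have "lead_coeff (f \<circ>\<^sub>p g) = coeff f d * b ^ d"
    using lead_coeff_comp[of g f] dg ge e by (simp add: d_def)
  then have lead: "padic_val p (lead_coeff (f \<circ>\<^sub>p g)) = 0"
    using f(1) assms(1,7) by (simp add: padic_val_mult padic_val_power_eq_0)
  define c where "c = coeff g 0"
  have c: "ereal (of_int s) \<le> padic_val p c" using ph[of 0] e by (simp add: c_def g_low)
  have "coeff (f \<circ>\<^sub>p g) 0 = poly f c"
    unfolding c_def poly_0_coeff_0[symmetric] by (rule poly_pcompose)
  also have "\<dots> = (\<Sum>i\<le>d. coeff f i * c ^ i)"
    unfolding d_def by (rule poly_altdef)
  also have "\<dots> = coeff f 0 + (\<Sum>i\<in>{1..d}. coeff f i * c ^ i)"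
    by (simp add: atMost_atLeast0 sum.atLeast_Suc_atMost)
  finally have c0: "coeff (f \<circ>\<^sub>p g) 0 = coeff f 0 + (\<Sum>i\<in>{1..d}. coeff f i * c ^ i)" .
  \<comment> \<open>The \<open>i\<close>-th term has valuation at least
    \<open>(r - i * t) + i * s = r + i * (s - t)\<close>, and \<open>i \<ge> 1\<close> leaves the
    uniform margin \<open>s - t > 0\<close> over the valuation \<open>r\<close> of
    \<open>coeff f 0\<close>.\<close>
  have tail: "ereal (of_int r + (of_int s - t)) \<le> padic_val p (\<Sum>i\<in>{1..d}. coeff f i * c ^ i)"
  proof (rule padic_val_sum_ge[OF assms(1)])
    fix i assume "i \<in> {1..d}"
    then have "1 * (of_int s - t) \<le> real i * (of_int s - t)"
      using st by (intro mult_right_mono) auto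
    then have "ereal (of_int r + (of_int s - t)) \<le> ereal ((of_int r - real i * t) + real i * of_int s)"
      by (simp add: algebra_simps)
    also have "\<dots> \<le> padic_val p (coeff f i * c ^ i)"
      using f(3) c assms(1)
      by (intro padic_val_mult_ge padic_val_power_ge) (auto simp: weight_ge_def)
    finally show "ereal (of_int r + (of_int s - t)) \<le> padic_val p (coeff f i * c ^ i)" .
  qed
  have const: "padic_val p (coeff (f \<circ>\<^sub>p g) 0) = ereal (of_int r)"
    unfolding c0 using st by (intro padic_val_add_dominant[OF assms(1) f(2) tail]) simp
  \<comment> \<open>The weight \<open>l\<close> is exactly the slope that purity demands in degree
    \<open>d * e\<close>.\<close>
  have "l = of_int r / real (degree (f \<circ>\<^sub>p g))" by (simp add: l_def t_def deg)
  then show ?thesis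
    using lead const weight_ge_pcompose[OF assms(1) f(3) wg] d e
    by (subst pure_poly_iff_weight_ge) (simp_all add: deg)
qed

end
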